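(* Let $\ell,m\ge 1$ be integers. The scheme over $F_{2^{\ell m}}$ described in the context, which shares an $\ell$-bit secret $s\in F_{2^\ell}$ into the $2^{\ell m-1}+1$ shares $Z_0,Z_1,\dots,Z_{2^{\ell m-1}-1}$ and $a_2$, is a $(3,2^{\ell m-1}+1)$-threshold secret sharing scheme with perfect correctness and perfect secrecy. That is, any three of these shares (together with knowledge of which shares they are) determine $s$; and for any set of at most two of these shares, their joint distribution is the same for all $s\in F_{2^\ell}$.
   Context: Let $g(x)\in F_2[x]$ be a monic irreducible polynomial of degree $\ell$, and let $F_{2^\ell}=F_2[x]/(g(x))$. An $\ell$-bit string $(c_0,\dots,c_{\ell-1})$ is identified with $\sum_{k=0}^{\ell-1} c_kx^k\in F_{2^\ell}$, and in this way an $\ell$-bit secret $s$ is viewed as an element of $F_{2^\ell}$. Let $g_1(y)\in F_{2^\ell}[y]$ be a monic irreducible polynomial of degree $m$, and let $F_{2^{\ell m}}=F_{2^\ell}[y]/(g_1(y))$, which contains $F_{2^\ell}$ as the constants. Every element of $F_{2^{\ell m}}$ is uniquely of the form $\sum_{k=0}^{m-1}\gamma_ky^k$ with $\gamma_k\in F_{2^\ell}$. Its constant coefficient is $\gamma_0$. For an integer $0\le j\le 2^{\ell m}-1$ with binary expansion $j=\sum_{r=0}^{\ell m-1}c_{j,r}2^r$, $c_{j,r}\in\{0,1\}$, let $\beta_j=\sum_{k=0}^{m-1}\Big(\sum_{r=0}^{\ell-1}c_{j,k\ell+r}x^r\Big)y^k\in F_{2^{\ell m}}$. The scheme: given the secret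 $s\in F_{2^\ell}$, choose $a_0,a_1$ independently and uniformly at random in $F_{2^{\ell m}}$. Let $a_2\in F_{2^\ell}$ be the constant coefficient of $a_1+s$. For $0\le i\le 2^{\ell m-1}-1$ set $$Z_i=a_0+a_1\beta_{2i}+a_2\beta_{2i}^2\in F_{2^{\ell m}}.$$ The shares are the $Z_i$, $0\le i\le 2^{\ell m-1}-1$, and one additional share equal to $a_2$. *)

theory Defs
  imports
    "HOL-Probability.Probability_Mass_Function"
    "HOL-Number_Theory.Residues"
    "HOL-Algebra.Polynomial_Divisibility"
begin

section \<open>Residue class rings of polynomials\<close>

text \<open>
  Polynomials are those of \<^theory>\<open>HOL-Algebra.Polynomials\<close>: coefficient lists, leading
  coefficient first.  Throughout, \<open>R[X]/(p)\<close> is the library's quotient ring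
  \<open>Rupt\<^bsub>R\<^esub> (carrier R) p\<close>, whose elements are cosets of the ideal generated by \<open>p\<close>.
\<close>

definition monic_irreducible :: "('a, 'b) ring_scheme \<Rightarrow> nat \<Rightarrow> 'a list \<Rightarrow> bool" where
  "monic_irreducible R n p \<longleftrightarrow>
     p \<in> carrier (poly_ring R) \<and>
     pirreducible\<^bsub>R\<^esub> (carrier R) p \<and>
     Polynomials.lead_coeff p = \<one>\<^bsub>R\<^esub> \<and>
     Polynomials.degree p = n"

abbreviation residue_field :: "('a, 'b) ring_scheme \<Rightarrow> 'a list \<Rightarrow> 'a list set ring" where
  "residue_field R p \<equiv> Rupt\<^bsub>R\<^esub> (carrier R) p"

definition residue_class :: "('a, 'b) ring_scheme \<Rightarrow> 'a list \<Rightarrow> 'a list \<Rightarrow> 'a list set" where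
  "residue_class R p q = (PIdl\<^bsub>poly_ring R\<^esub> p) +>\<^bsub>poly_ring R\<^esub> q"

definition const_class :: "('a, 'b) ring_scheme \<Rightarrow> 'a list \<Rightarrow> 'a \<Rightarrow> 'a list set" where
  "const_class R p c = residue_class R p (ring.poly_of_const R c)"

text \<open>The element \<open>\<Sum>k<n. \<gamma> k * X^k\<close> of \<open>R[X]/(p)\<close>, where \<open>n\<close> is the degree of \<open>p\<close>.\<close>

definition power_sum :: "('a, 'b) ring_scheme \<Rightarrow> 'a list \<Rightarrow> (nat \<Rightarrow> 'a) \<Rightarrow> 'a list set" where
  "power_sum R p \<gamma> =
     (\<Oplus>\<^bsub>residue_field R p\<^esub> k \<in> {..<Polynomials.degree p}.
        const_class R p (\<gamma> k) \<otimes>\<^bsub>residue_field R p\<^esub>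
        (residue_class R p X\<^bsub>R\<^esub> [^]\<^bsub>residue_field R p\<^esub> k))"

definition const_coeff :: "('a, 'b) ring_scheme \<Rightarrow> 'a list \<Rightarrow> 'a list set \<Rightarrow> 'a" where
  "const_coeff R p z =
     (THE c. \<exists>\<gamma> \<in> {..<Polynomials.degree p} \<rightarrow> carrier R. z = power_sum R p \<gamma> \<and> c = \<gamma> 0)"


section \<open>Threshold secret sharing\<close>

text \<open>
  A scheme is given by its secrets \<open>S\<close>, its share positions \<open>P\<close>, and the joint distribution
  \<open>deal s\<close> of all shares of a secret \<open>s\<close>.  The shares at the positions in \<open>A\<close> are represented by
  the restriction to \<open>A\<close> of the share assignment; a reconstruction function may depend on \<open>A\<close>.
\<close>

definition perfectly_correct ::
    "'s set \<Rightarrow> 'i set \<Rightarrow> ('s \<Rightarrow> ('i \<Rightarrow> 'v) pmf) \<Rightarrow> nat \<Rightarrow> bool" where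
  "perfectly_correct S P deal t \<longleftrightarrow>
     (\<forall>A. A \<subseteq> P \<and> card A = t \<longrightarrow>
        (\<exists>recover. \<forall>s \<in> S. \<forall>sh \<in> set_pmf (deal s). recover (restrict sh A) = s))"

definition perfectly_secret ::
    "'s set \<Rightarrow> 'i set \<Rightarrow> ('s \<Rightarrow> ('i \<Rightarrow> 'v) pmf) \<Rightarrow> nat \<Rightarrow> bool" where
  "perfectly_secret S P deal t \<longleftrightarrow>
     (\<forall>A. A \<subseteq> P \<and> card A < t \<longrightarrow>
        (\<forall>s \<in> S. \<forall>s' \<in> S.
           map_pmf (\<lambda>sh. restrict sh A) (deal s) = map_pmf (\<lambda>sh. restrict sh A) (deal s')))"

definition threshold_scheme ::
    "'s set \<Rightarrow> 'i set \<Rightarrow> ('s \<Rightarrow> ('i \<Rightarrow> 'v) pmf) \<Rightarrow> nat \<Rightarrow> nat \<Rightarrow> bool" where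
  "threshold_scheme S P deal t n \<longleftrightarrow>
     finite P \<and> card P = n \<and> perfectly_correct S P deal t \<and> perfectly_secret S P deal t"


section \<open>The scheme\<close>

abbreviation F2 :: "int ring" where
  "F2 \<equiv> residue_ring 2"

abbreviation small_field :: "int list \<Rightarrow> int list set ring" where
  "small_field g \<equiv> residue_field F2 g"

abbreviation large_field :: "int list \<Rightarrow> int list set list \<Rightarrow> int list set list set ring" where
  "large_field g g1 \<equiv> residue_field (small_field g) g1"

definition beta :: "int list \<Rightarrow> int list set list \<Rightarrow> nat \<Rightarrow> int list set list set" where
  "beta g g1 j =
     power_sum (small_field g) g1
       (\<lambda>k. power_sum F2 g (\<lambda>r. of_bool (bit j (k * Polynomials.degree g + r))))"

datatype share_position = Z_share nat | A2_share

definition positions :: "nat \<Rightarrow> nat \<Rightarrow> share_position set" where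
  "positions l m = insert A2_share (Z_share ` {i. i \<le> 2 ^ (l * m - 1) - 1})"

text \<open>
  The shares \<open>Z\<^sub>i\<close> lie in the large field and the share \<open>a\<^sub>2\<close> in the small one, hence the sum type.
\<close>

definition shares ::
    "int list \<Rightarrow> int list set list \<Rightarrow> int list set \<Rightarrow>
     int list set list set \<Rightarrow> int list set list set \<Rightarrow>
     share_position \<Rightarrow> int list set list set + int list set" where
  "shares g g1 s a0 a1 pos =
     (let K = small_field g; L = large_field g g1;
          a2 = const_coeff K g1 (a1 \<oplus>\<^bsub>L\<^esub> const_class K g1 s)
      in case pos of
           Z_share i \<Rightarrow>
             Inl (a0 \<oplus>\<^bsub>L\<^esub> a1 \<otimes>\<^bsub>L\<^esub> beta g g1 (2 * i)
                     \<oplus>\<^bsub>L\<^esub> const_class K g1 a2 \<otimes>\<^bsub>L\<^esub> (beta g g1 (2 * i) [^]\<^bsub>L\<^esub> (2::nat)))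
         | A2_share \<Rightarrow> Inr a2)"

definition deal ::
    "int list \<Rightarrow> int list set list \<Rightarrow> int list set \<Rightarrow>
     (share_position \<Rightarrow> int list set list set + int list set) pmf" where
  "deal g g1 s =
     map_pmf (\<lambda>(a0, a1). shares g g1 s a0 a1)
       (pair_pmf (pmf_of_set (carrier (large_field g g1)))
                 (pmf_of_set (carrier (large_field g g1))))"

end

theory Submission
  imports Defs
begin

text \<open>
  Three values of the polynomial \<open>a\<^sub>0 + a\<^sub>1 y + a\<^sub>2 y\<^sup>2\<close>, or two values together with \<open>a\<^sub>2\<close>, determine
  \<open>a\<^sub>1\<close> and \<open>a\<^sub>2\<close> and hence \<open>s\<close>, since \<open>a\<^sub>2 = c(a\<^sub>1) + s\<close> with \<open>c\<close> the constant coefficient.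
  For secrecy, the values at \<open>b, b'\<close> are unchanged when the multiple \<open>e (y - b) (y - b')\<close> with
  \<open>e\<close> in the small field is added to the polynomial.  This is compatible with replacing \<open>s\<close> by
  \<open>s'\<close> iff \<open>e (1 + c(b + b')) = s' - s\<close>, which is solvable because the points have even index:
  \<open>c(b + b')\<close> has vanishing constant coefficient over \<open>F\<^sub>2\<close>, so it is not \<open>-1\<close>.
  So the views of two shares for \<open>s\<close> and \<open>s'\<close> differ by a translation of the uniformly
  distributed pair \<open>(a\<^sub>0, a\<^sub>1)\<close>.
\<close>

section \<open>Power bases of residue fields\<close>

text \<open>Coefficient lists put the leading coefficient first, hence the reversed range. This lets
  power sums be treated as evaluations, which homomorphisms preserve.\<close>

lemma (in ring) eval_map_rev_upt:
  assumes "x \<in> carrier R" and "f \<in> {..<n} \<rightarrow> carrier R"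
  shows "eval (map f (rev [0..<n])) x = (\<Oplus>k\<in>{..<n}. f k \<otimes> x [^] k)"
  using assms(2)
proof (induction n)
  case 0
  then show ?case by simp
next
  case (Suc n)
  then have f: "f k \<in> carrier R" if "k \<le> n" for k
    using that by auto
  then have "eval (map f (rev [0..<n])) x = (\<Oplus>k\<in>{..<n}. f k \<otimes> x [^] k)"
    by (intro Suc.IH) auto
  moreover have "(\<Oplus>k\<in>{..<Suc n}. f k \<otimes> x [^] k)
      = f n \<otimes> x [^] n \<oplus> (\<Oplus>k\<in>{..<n}. f k \<otimes> x [^] k)"
    using f assms(1) by (simp add: lessThan_Suc)
  ultimately show ?case
    by simp
qed

text \<open>\<open>normalize\<close> only strips leading zeros; their images under \<open>h\<close>
  are zero and contribute nothing to the value.\<close>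

lemma (in ring_hom_ring) eval_map_normalize:
  assumes "set xs \<subseteq> carrier R" and "x \<in> carrier S"
  shows "eval (map h (R.normalize xs)) x = eval (map h xs) x"
  using assms
proof (induction xs)
  case (Cons a xs)
  have "set (map h xs) \<subseteq> carrier S"
    using Cons.prems by auto
  from eval_in_carrier[OF this] Cons show ?case
    by auto
qed simp

text \<open>The added terms are the coefficients of \<open>e (X - y) (X - z)\<close>, evaluated at
  the root \<open>y\<close>.\<close>

lemma (in cring) quadratic_translate_fixing_two_points:
  assumes "a0 \<in> carrier R" "a1 \<in> carrier R" "c \<in> carrier R" "e \<in> carrier R"
    and "y \<in> carrier R" "z \<in> carrier R"
  shows "a0 \<oplus> e \<otimes> y \<otimes> z \<oplus> (a1 \<oplus> (\<ominus> e) \<otimes> (y \<oplus> z)) \<otimes> y \<oplus> (c \<oplus> e) \<otimes> (y \<otimes> y)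
    = a0 \<oplus> a1 \<otimes> y \<oplus> c \<otimes> (y \<otimes> y)"
  using assms by algebra

text \<open>Stated over an arbitrary base field because it is instantiated twice: for
  \<open>g\<close> over \<open>F2\<close> and for \<open>g1\<close> over the small field.\<close>

locale residue_field_extension = Ring.field R for R (structure) and n :: nat and p +
  assumes monic_irreducible: "monic_irreducible R n p"
begin

abbreviation L where "L \<equiv> residue_field R p"
abbreviation \<iota> where "\<iota> \<equiv> const_class R p"

lemma p_carrier: "p \<in> carrier (poly_ring R)"
  and degree_p: "degree p = n"
  and p_irreducible: "pirreducible (carrier R) p"
  using monic_irreducible unfolding monic_irreducible_def by auto

lemma n_pos: "0 < n"
  using pirreducible_degree[OF carrier_is_subfield p_carrier p_irreducible] degree_p by simp

lemma p_nonzero: "p \<noteq> []"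
  using n_pos degree_p by auto

lemma residue_class_eq: "residue_class R p = rupture_surj (carrier R) p"
  by (simp add: residue_class_def fun_eq_iff)

lemma const_class_eq: "\<iota> = residue_class R p \<circ> poly_of_const"
  by (simp add: const_class_def fun_eq_iff)

lemma field_L: "Ring.field L"
  using rupture_is_field_iff_pirreducible[OF carrier_is_subfield p_carrier] p_irreducible by simp

sublocale L: Ring.field L
  by (rule field_L)

sublocale residue: ring_hom_ring "poly_ring R" L "residue_class R p"
  unfolding residue_class_eq by (rule rupture_surj_hom(2)[OF carrier_is_subring p_carrier])

sublocale \<iota>: ring_hom_ring R L \<iota>
  using rupture_surj_norm_is_hom[OF carrier_is_subring p_carrier]
  by (intro ring_hom_ringI2) (auto simp: const_class_eq residue_class_eq ring_axioms L.ring_axioms)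

section \<open>Existence and uniqueness of coordinates\<close>

text \<open>A polynomial is its own evaluation at \<open>X\<close> once its coefficients are read as
  constants; the quotient map carries this evaluation to the power sum. Facts about representatives
  of degree below \<open>n\<close> thus become facts about coordinates.\<close>

lemma power_sum_eq_residue_class:
  assumes "\<gamma> \<in> {..<n} \<rightarrow> carrier R"
  shows "power_sum R p \<gamma> = residue_class R p (normalize (map \<gamma> (rev [0..<n])))"
proof -
  let ?xs = "map \<gamma> (rev [0..<n])" and ?x = "residue_class R p X"
  have xs: "set ?xs \<subseteq> carrier R"
    using assms by auto
  have q: "normalize ?xs \<in> carrier (poly_ring R)"
    using normalize_gives_polynomial[OF xs] by (simp add: univ_poly_carrier)
  have X: "X \<in> carrier (poly_ring R)"
    by (rule var_closed(1)[OF carrier_is_subring])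
  have x: "?x \<in> carrier L"
    using X by simp
  have "residue_class R p (normalize ?xs)
      = residue_class R p (residue.R.eval (map poly_of_const (normalize ?xs)) X)"
    using eval_rewrite[OF carrier_is_subring q] by simp
  also have "\<dots> = L.eval (map \<iota> (normalize ?xs)) ?x"
    using residue.eval_hom[OF residue.R.carrier_is_subring X
        map_norm_in_poly_ring_carrier[OF carrier_is_subring q]]
    by (simp add: const_class_eq)
  also have "\<dots> = L.eval (map \<iota> ?xs) ?x"
    using \<iota>.eval_map_normalize[OF xs x] .
  also have "\<dots> = L.eval (map (\<iota> \<circ> \<gamma>) (rev [0..<n])) ?x"
    by simp
  also have "\<dots> = power_sum R p \<gamma>"
    unfolding power_sum_def degree_p
    using assms x by (subst L.eval_map_rev_upt) (auto simp: Pi_def)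
  finally show ?thesis ..
qed

lemma power_sum_closed:
  assumes "\<gamma> \<in> {..<n} \<rightarrow> carrier R"
  shows "power_sum R p \<gamma> \<in> carrier L"
proof -
  have "residue_class R p X \<in> carrier L"
    using var_closed(1)[OF carrier_is_subring] by simp
  then show ?thesis
    unfolding power_sum_def degree_p using assms by (intro L.finsum_closed) (auto simp: Pi_def)
qed

text \<open>Division by \<open>p\<close> leaves a representative of degree below \<open>n\<close>,
  whose coefficients serve as coordinates.\<close>

lemma power_sum_surj:
  assumes "z \<in> carrier L"
  obtains \<gamma> where "\<gamma> \<in> {..<n} \<rightarrow>\<^sub>E carrier R" and "z = power_sum R p \<gamma>"
proof -
  obtain q where q: "q \<in> carrier (poly_ring R)" "length q \<le> n" "z = residue_class R p q"
    using assms
    unfolding rupture_carrier_as_pmod_image[OF carrier_is_subfield p_carrier, symmetric]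
      pmod_image_characterization[OF carrier_is_subfield p_carrier p_nonzero] residue_class_eq
      degree_p
    by auto
  \<comment> \<open>The restriction makes \<gamma> extensional, so that over a finite
    \<open>R\<close> only finitely many coordinate functions occur; \<open>finite_carrier_L\<close>
    relies on this.\<close>
  define \<gamma> where "\<gamma> = restrict (coeff q) {..<n}"
  have pol: "polynomial (carrier R) q"
    using q(1) by (simp add: univ_poly_carrier)
  have coeff: "coeff q i \<in> carrier R" for i
    using polynomial_in_carrier[OF carrier_is_subring pol] by simp
  have set: "set (map \<gamma> (rev [0..<n])) \<subseteq> carrier R"
    using coeff by (auto simp: \<gamma>_def)
  have "coeff (map \<gamma> (rev [0..<n])) = coeff q"
  proof
    fix i show "coeff (map \<gamma> (rev [0..<n])) i = coeff q i"
    proof (cases "i < n")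
      case True
      then show ?thesis
        by (subst coeff_nth) (auto simp: \<gamma>_def rev_nth)
    next
      case False
      then show ?thesis
        using q(2) by (simp add: coeff_length)
    qed
  qed
  then have "normalize (map \<gamma> (rev [0..<n])) = q"
    by (simp add: coeff_iff_polynomial_cond[OF normalize_gives_polynomial[OF set] pol]
        normalize_coeff[symmetric])
  moreover have "\<gamma> \<in> {..<n} \<rightarrow>\<^sub>E carrier R"
    using coeff by (auto simp: \<gamma>_def)
  ultimately show thesis
    using power_sum_eq_residue_class[of \<gamma>] q(3) by (intro that[of \<gamma>]) auto
qed

text \<open>Distinct polynomials of degree below \<open>n\<close> lie in distinct cosets modulo
  \<open>p\<close>. Coordinates are then read off with \<open>coeff\<close>, which
  \<open>normalize\<close> preserves.\<close>

lemma power_sum_inj: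
  assumes "\<gamma> \<in> {..<n} \<rightarrow> carrier R" and "\<delta> \<in> {..<n} \<rightarrow> carrier R"
    and "power_sum R p \<gamma> = power_sum R p \<delta>" and "k < n"
  shows "\<gamma> k = \<delta> k"
proof -
  let ?q = "\<lambda>\<gamma>. normalize (map \<gamma> (rev [0..<n]))"
  have mem: "?q \<gamma> \<in> {q \<in> carrier (poly_ring R). length q \<le> degree p}"
    if "\<gamma> \<in> {..<n} \<rightarrow> carrier R" for \<gamma>
  proof -
    have "set (map \<gamma> (rev [0..<n])) \<subseteq> carrier R"
      using that by auto
    then show ?thesis
      using normalize_gives_polynomial normalize_length_le[of "map \<gamma> (rev [0..<n])"]
      unfolding degree_p by (simp add: univ_poly_carrier[symmetric])
  qed
  have "?q \<gamma> = ?q \<delta>"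
    using rupture_surj_inj_on[OF carrier_is_subfield p_carrier] assms(3)
      mem[OF assms(1)] mem[OF assms(2)]
    unfolding pmod_image_characterization[OF carrier_is_subfield p_carrier p_nonzero]
      power_sum_eq_residue_class[OF assms(1)] power_sum_eq_residue_class[OF assms(2)]
      residue_class_eq
    by (rule inj_onD)
  then have "coeff (map \<gamma> (rev [0..<n])) k = coeff (map \<delta> (rev [0..<n])) k"
    by (subst (1 2) normalize_coeff) simp
  moreover have "coeff (map \<gamma> (rev [0..<n])) k = \<gamma> k" for \<gamma>
    using assms(4) by (subst coeff_nth) (auto simp: rev_nth)
  ultimately show ?thesis
    by simp
qed

lemma finite_carrier_L:
  assumes "finite (carrier R)"
  shows "finite (carrier L)"
proof (rule finite_subset)
  show "carrier L \<subseteq> power_sum R p ` ({..<n} \<rightarrow>\<^sub>E carrier R)"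
    using power_sum_surj by blast
qed (auto intro: finite_PiE assms)

section \<open>Linearity of the coordinates and of the constant coefficient\<close>

lemma power_sum_add:
  assumes "\<gamma> \<in> {..<n} \<rightarrow> carrier R" and "\<delta> \<in> {..<n} \<rightarrow> carrier R"
  shows "power_sum R p \<gamma> \<oplus>\<^bsub>L\<^esub> power_sum R p \<delta> = power_sum R p (\<lambda>k. \<gamma> k \<oplus> \<delta> k)"
proof -
  let ?x = "residue_class R p X"
  have x: "?x \<in> carrier L"
    using var_closed(1)[OF carrier_is_subring] by simp
  have "power_sum R p (\<lambda>k. \<gamma> k \<oplus> \<delta> k) = (\<Oplus>\<^bsub>L\<^esub>k\<in>{..<n}.
      \<iota> (\<gamma> k) \<otimes>\<^bsub>L\<^esub> ?x [^]\<^bsub>L\<^esub> k \<oplus>\<^bsub>L\<^esub> \<iota> (\<delta> k) \<otimes>\<^bsub>L\<^esub> ?x [^]\<^bsub>L\<^esub> k)"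
    unfolding power_sum_def degree_p using assms x
    by (intro L.add.finprod_cong') (simp_all add: Pi_def L.l_distr)
  also have "\<dots> = power_sum R p \<gamma> \<oplus>\<^bsub>L\<^esub> power_sum R p \<delta>"
    unfolding power_sum_def degree_p using assms x
    by (intro L.finsum_addf) (simp_all add: Pi_def)
  finally show ?thesis ..
qed

lemma power_sum_smult:
  assumes "c \<in> carrier R" and "\<gamma> \<in> {..<n} \<rightarrow> carrier R"
  shows "\<iota> c \<otimes>\<^bsub>L\<^esub> power_sum R p \<gamma> = power_sum R p (\<lambda>k. c \<otimes> \<gamma> k)"
proof -
  let ?x = "residue_class R p X"
  have x: "?x \<in> carrier L"
    using var_closed(1)[OF carrier_is_subring] by simp
  show ?thesis
    unfolding power_sum_def degree_p using assms x
    by (subst L.finsum_rdistr, simp_all add: Pi_def,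
        intro L.add.finprod_cong') (simp_all add: Pi_def L.m_assoc)
qed

lemma const_class_eq_power_sum:
  assumes "c \<in> carrier R"
  shows "\<iota> c = power_sum R p (\<lambda>k. if k = 0 then c else \<zero>)"
proof -
  let ?x = "residue_class R p X"
  have x: "?x \<in> carrier L"
    using var_closed(1)[OF carrier_is_subring] by simp
  have "power_sum R p (\<lambda>k. if k = 0 then c else \<zero>)
      = (\<Oplus>\<^bsub>L\<^esub>k\<in>{..<n}. if 0 = k then \<iota> c else \<zero>\<^bsub>L\<^esub>)"
    unfolding power_sum_def degree_p using assms x
    by (intro L.finsum_cong') auto
  also have "\<dots> = \<iota> c"
    using n_pos assms by (subst L.finsum_singleton) auto
  finally show ?thesis ..
qed

text \<open>The description in \<open>const_coeff\<close> is well defined because coordinates are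
  unique; index 0 is a coordinate by \<open>n_pos\<close>.\<close>

lemma const_coeff_power_sum:
  assumes "\<gamma> \<in> {..<n} \<rightarrow> carrier R"
  shows "const_coeff R p (power_sum R p \<gamma>) = \<gamma> 0"
  unfolding const_coeff_def degree_p
proof (rule the_equality)
  show "\<exists>\<delta>\<in>{..<n} \<rightarrow> carrier R. power_sum R p \<gamma> = power_sum R p \<delta> \<and> \<gamma> 0 = \<delta> 0"
    using assms by blast
qed (use power_sum_inj[OF assms _ _ n_pos] in force)

lemma const_coeff_closed:
  assumes "z \<in> carrier L"
  shows "const_coeff R p z \<in> carrier R"
  using assms
proof (rule power_sum_surj)
  fix \<gamma> assume "\<gamma> \<in> {..<n} \<rightarrow>\<^sub>E carrier R" "z = power_sum R p \<gamma>"
  then show ?thesis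
    using n_pos by (subst \<open>z = _\<close>, subst const_coeff_power_sum) auto
qed

lemma const_coeff_add:
  assumes "z \<in> carrier L" and "w \<in> carrier L"
  shows "const_coeff R p (z \<oplus>\<^bsub>L\<^esub> w) = const_coeff R p z \<oplus> const_coeff R p w"
proof -
  obtain \<gamma> where \<gamma>: "\<gamma> \<in> {..<n} \<rightarrow>\<^sub>E carrier R" "z = power_sum R p \<gamma>"
    using power_sum_surj[OF assms(1)] .
  obtain \<delta> where \<delta>: "\<delta> \<in> {..<n} \<rightarrow>\<^sub>E carrier R" "w = power_sum R p \<delta>"
    using power_sum_surj[OF assms(2)] .
  have *: "\<gamma> \<in> {..<n} \<rightarrow> carrier R" "\<delta> \<in> {..<n} \<rightarrow> carrier R"
      "(\<lambda>k. \<gamma> k \<oplus> \<delta> k) \<in> {..<n} \<rightarrow> carrier R"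
    using \<gamma>(1) \<delta>(1) by auto
  show ?thesis
    unfolding \<gamma>(2) \<delta>(2) power_sum_add[OF *(1,2)] using * by (simp add: const_coeff_power_sum)
qed

text \<open>Together with \<open>const_coeff_add\<close> this gives linearity over \<open>R\<close>.
  For \<open>n > 1\<close> the constant coefficient is not multiplicative on \<open>L\<close>, so
  one factor is restricted to constants.\<close>

lemma const_coeff_smult:
  assumes "c \<in> carrier R" and "z \<in> carrier L"
  shows "const_coeff R p (\<iota> c \<otimes>\<^bsub>L\<^esub> z) = c \<otimes> const_coeff R p z"
proof -
  obtain \<gamma> where \<gamma>: "\<gamma> \<in> {..<n} \<rightarrow>\<^sub>E carrier R" "z = power_sum R p \<gamma>"
    using power_sum_surj[OF assms(2)] .
  have *: "\<gamma> \<in> {..<n} \<rightarrow> carrier R" "(\<lambda>k. c \<otimes> \<gamma> k) \<in> {..<n} \<rightarrow> carrier R"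
    using \<gamma>(1) assms(1) by auto
  show ?thesis
    unfolding \<gamma>(2) power_sum_smult[OF assms(1) *(1)] using * by (simp add: const_coeff_power_sum)
qed

lemma const_coeff_const_class:
  assumes "c \<in> carrier R"
  shows "const_coeff R p (\<iota> c) = c"
  using assms by (simp add: const_class_eq_power_sum const_coeff_power_sum)


subsection \<open>Values of masked quadratic polynomials\<close>

abbreviation cc where "cc \<equiv> const_coeff R p"

definition quad where
  "quad a0 a1 a2 b = a0 \<oplus>\<^bsub>L\<^esub> a1 \<otimes>\<^bsub>L\<^esub> b \<oplus>\<^bsub>L\<^esub> \<iota> a2 \<otimes>\<^bsub>L\<^esub> (b [^]\<^bsub>L\<^esub> (2::nat))"

text \<open>The scheme's \<open>a2\<close>. By additivity of \<open>cc\<close> it is a one-time pad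
  of \<open>s\<close> with key \<open>cc a1\<close>, see \<open>mask_eq\<close>.\<close>

definition mask where
  "mask s a1 = cc (a1 \<oplus>\<^bsub>L\<^esub> \<iota> s)"

lemma mask_closed: "s \<in> carrier R \<Longrightarrow> a1 \<in> carrier L \<Longrightarrow> mask s a1 \<in> carrier R"
  unfolding mask_def by (intro const_coeff_closed) auto

lemma mask_eq:
  "s \<in> carrier R \<Longrightarrow> a1 \<in> carrier L \<Longrightarrow> mask s a1 = cc a1 \<oplus> s"
  unfolding mask_def by (simp add: const_coeff_add const_coeff_const_class)

lemma mask_inj:
  assumes "s \<in> carrier R" "s' \<in> carrier R" "a1 \<in> carrier L" "mask s a1 = mask s' a1"
  shows "s = s'"
  using assms const_coeff_closed[OF assms(3)] by (simp add: mask_eq)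

lemma const_class_inj:
  "c \<in> carrier R \<Longrightarrow> d \<in> carrier R \<Longrightarrow> \<iota> c = \<iota> d \<Longrightarrow> c = d"
  by (metis const_coeff_const_class)

section \<open>Reconstruction of the secret from values\<close>

text \<open>The difference of the two polynomials vanishes at \<open>b\<close> and
  \<open>b'\<close>. Subtracting the two equations removes the constant term and leaves a multiple
  of \<open>b - b'\<close>, which cancels in a field.\<close>

lemma quad_diff:
  assumes "a0 \<in> carrier L" "a1 \<in> carrier L" "a2 \<in> carrier R"
    and "a0' \<in> carrier L" "a1' \<in> carrier L" "a2' \<in> carrier R"
    and "b \<in> carrier L" "b' \<in> carrier L" "b \<noteq> b'"
    and "quad a0 a1 a2 b = quad a0' a1' a2' b" "quad a0 a1 a2 b' = quad a0' a1' a2' b'"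
  shows "(a1 \<ominus>\<^bsub>L\<^esub> a1') \<oplus>\<^bsub>L\<^esub> (\<iota> a2 \<ominus>\<^bsub>L\<^esub> \<iota> a2') \<otimes>\<^bsub>L\<^esub> (b \<oplus>\<^bsub>L\<^esub> b') = \<zero>\<^bsub>L\<^esub>"
proof -
  define u v w where "u = a0 \<ominus>\<^bsub>L\<^esub> a0'" and "v = a1 \<ominus>\<^bsub>L\<^esub> a1'" and "w = \<iota> a2 \<ominus>\<^bsub>L\<^esub> \<iota> a2'"
  have c: "\<iota> a2 \<in> carrier L" "\<iota> a2' \<in> carrier L"
    using assms by auto
  have uvw: "u \<in> carrier L" "v \<in> carrier L" "w \<in> carrier L"
    using assms c by (auto simp: u_def v_def w_def)
  have zero: "u \<oplus>\<^bsub>L\<^esub> v \<otimes>\<^bsub>L\<^esub> x \<oplus>\<^bsub>L\<^esub> w \<otimes>\<^bsub>L\<^esub> (x \<otimes>\<^bsub>L\<^esub> x) = \<zero>\<^bsub>L\<^esub>"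
    if x: "x \<in> carrier L" and eq: "quad a0 a1 a2 x = quad a0' a1' a2' x" for x
  proof -
    have sq: "x [^]\<^bsub>L\<^esub> (2::nat) = x \<otimes>\<^bsub>L\<^esub> x" "x \<otimes>\<^bsub>L\<^esub> x \<in> carrier L"
      using x by (simp_all add: numeral_2_eq_2)
    \<comment> \<open>The square is generalized to an arbitrary \<open>q\<close>, since the identity
      is linear in it.\<close>
    have "u \<oplus>\<^bsub>L\<^esub> v \<otimes>\<^bsub>L\<^esub> x \<oplus>\<^bsub>L\<^esub> w \<otimes>\<^bsub>L\<^esub> q = (a0 \<oplus>\<^bsub>L\<^esub> a1 \<otimes>\<^bsub>L\<^esub> x \<oplus>\<^bsub>L\<^esub> \<iota> a2 \<otimes>\<^bsub>L\<^esub> q)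
        \<ominus>\<^bsub>L\<^esub> (a0' \<oplus>\<^bsub>L\<^esub> a1' \<otimes>\<^bsub>L\<^esub> x \<oplus>\<^bsub>L\<^esub> \<iota> a2' \<otimes>\<^bsub>L\<^esub> q)" if "q \<in> carrier L" for q
      unfolding u_def v_def w_def using assms(1,2,4,5) c x that by algebra
    from this[OF sq(2)] have "u \<oplus>\<^bsub>L\<^esub> v \<otimes>\<^bsub>L\<^esub> x \<oplus>\<^bsub>L\<^esub> w \<otimes>\<^bsub>L\<^esub> (x \<otimes>\<^bsub>L\<^esub> x)
        = quad a0 a1 a2 x \<ominus>\<^bsub>L\<^esub> quad a0' a1' a2' x"
      by (simp add: quad_def sq(1))
    moreover have "quad a0' a1' a2' x \<in> carrier L"
      using assms(4,5) c x by (simp add: quad_def)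
    ultimately show ?thesis
      by (simp add: eq)
  qed
  have "(b \<ominus>\<^bsub>L\<^esub> b') \<otimes>\<^bsub>L\<^esub> (v \<oplus>\<^bsub>L\<^esub> w \<otimes>\<^bsub>L\<^esub> (b \<oplus>\<^bsub>L\<^esub> b'))
      = (u \<oplus>\<^bsub>L\<^esub> v \<otimes>\<^bsub>L\<^esub> b \<oplus>\<^bsub>L\<^esub> w \<otimes>\<^bsub>L\<^esub> (b \<otimes>\<^bsub>L\<^esub> b))
        \<ominus>\<^bsub>L\<^esub> (u \<oplus>\<^bsub>L\<^esub> v \<otimes>\<^bsub>L\<^esub> b' \<oplus>\<^bsub>L\<^esub> w \<otimes>\<^bsub>L\<^esub> (b' \<otimes>\<^bsub>L\<^esub> b'))"
    using uvw assms(7,8) by algebra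
  also have "\<dots> = \<zero>\<^bsub>L\<^esub>"
    using zero assms(7,8,10,11) by simp
  finally show ?thesis
    using assms(7-9) uvw by (simp add: L.integral_iff u_def v_def w_def)
qed

text \<open>\<open>quad_diff\<close> on the pairs \<open>b, b'\<close> and \<open>b, b''\<close>
  gives two linear equations for the differences of \<open>a1\<close> and of the masks. Their
  determinant is \<open>b' - b''\<close> up to sign, so both differences vanish.\<close>

lemma three_values_determine_secret:
  assumes "a0 \<in> carrier L" "a1 \<in> carrier L" "s \<in> carrier R"
    and "a0' \<in> carrier L" "a1' \<in> carrier L" "s' \<in> carrier R"
    and "b \<in> carrier L" "b' \<in> carrier L" "b'' \<in> carrier L" "b \<noteq> b'" "b \<noteq> b''" "b' \<noteq> b''"
    and "\<And>x. x \<in> {b, b', b''} \<Longrightarrow>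
      quad a0 a1 (mask s a1) x = quad a0' a1' (mask s' a1') x"
  shows "s = s'"
proof -
  define u v where "u = a1 \<ominus>\<^bsub>L\<^esub> a1'" and "v = \<iota> (mask s a1) \<ominus>\<^bsub>L\<^esub> \<iota> (mask s' a1')"
  have m: "mask s a1 \<in> carrier R" "mask s' a1' \<in> carrier R"
    using assms mask_closed by auto
  then have uv: "u \<in> carrier L" "v \<in> carrier L"
    using assms by (auto simp: u_def v_def)
  have 1: "u \<oplus>\<^bsub>L\<^esub> v \<otimes>\<^bsub>L\<^esub> (b \<oplus>\<^bsub>L\<^esub> b') = \<zero>\<^bsub>L\<^esub>"
    unfolding u_def v_def by (rule quad_diff[of a0 _ _ a0']) (use assms m in simp_all)
  have 2: "u \<oplus>\<^bsub>L\<^esub> v \<otimes>\<^bsub>L\<^esub> (b \<oplus>\<^bsub>L\<^esub> b'') = \<zero>\<^bsub>L\<^esub>"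
    unfolding u_def v_def by (rule quad_diff[of a0 _ _ a0']) (use assms m in simp_all)
  have "v \<otimes>\<^bsub>L\<^esub> (b' \<ominus>\<^bsub>L\<^esub> b'')
      = (u \<oplus>\<^bsub>L\<^esub> v \<otimes>\<^bsub>L\<^esub> (b \<oplus>\<^bsub>L\<^esub> b')) \<ominus>\<^bsub>L\<^esub> (u \<oplus>\<^bsub>L\<^esub> v \<otimes>\<^bsub>L\<^esub> (b \<oplus>\<^bsub>L\<^esub> b''))"
    using uv assms(7-9) by algebra
  then have "v \<otimes>\<^bsub>L\<^esub> (b' \<ominus>\<^bsub>L\<^esub> b'') = \<zero>\<^bsub>L\<^esub>"
    unfolding 1 2 by simp
  then have v: "v = \<zero>\<^bsub>L\<^esub>"
    using assms(8,9,12) uv by (simp add: L.integral_iff L.r_right_minus_eq)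
  with 1 have "u = \<zero>\<^bsub>L\<^esub>"
    using uv assms(7,8) by simp
  then have "a1 = a1'"
    using assms(2,5) by (simp add: u_def)
  moreover have "mask s a1 = mask s' a1'"
    using v m by (intro const_class_inj) (simp_all add: v_def)
  ultimately show ?thesis
    using mask_inj[OF assms(3,6,2)] by simp
qed

text \<open>Equal masks remove the second summand of \<open>quad_diff\<close>, which then says
  \<open>a1 = a1'\<close>.\<close>

lemma two_values_and_mask_determine_secret:
  assumes "a0 \<in> carrier L" "a1 \<in> carrier L" "s \<in> carrier R"
    and "a0' \<in> carrier L" "a1' \<in> carrier L" "s' \<in> carrier R"
    and "b \<in> carrier L" "b' \<in> carrier L" "b \<noteq> b'"
    and "\<And>x. x \<in> {b, b'} \<Longrightarrow> quad a0 a1 (mask s a1) x = quad a0' a1' (mask s' a1') x"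
    and "mask s a1 = mask s' a1'"
  shows "s = s'"
proof -
  have m: "mask s a1 \<in> carrier R" "mask s' a1' \<in> carrier R"
    using assms mask_closed by auto
  have "(a1 \<ominus>\<^bsub>L\<^esub> a1') \<oplus>\<^bsub>L\<^esub> (\<iota> (mask s a1) \<ominus>\<^bsub>L\<^esub> \<iota> (mask s' a1')) \<otimes>\<^bsub>L\<^esub> (b \<oplus>\<^bsub>L\<^esub> b')
      = \<zero>\<^bsub>L\<^esub>"
    by (rule quad_diff[of a0 _ _ a0']) (use assms m in simp_all)
  moreover have "\<iota> (mask s a1) \<ominus>\<^bsub>L\<^esub> \<iota> (mask s' a1') = \<zero>\<^bsub>L\<^esub>"
    using m by (simp add: assms(11))
  ultimately have "a1 = a1'"
    using assms(1-8) by simp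
  then show ?thesis
    using mask_inj[OF assms(3,6,2)] assms(11) by simp
qed

section \<open>Translations of the randomness that hide the secret\<close>

text \<open>The points may coincide, so that a view of a single value needs no separate
  case.\<close>

lemma translation_fixing_two_values:
  assumes "s \<in> carrier R" "s' \<in> carrier R" "b \<in> carrier L" "b' \<in> carrier L"
    and nz: "\<one> \<oplus> cc (b \<oplus>\<^bsub>L\<^esub> b') \<noteq> \<zero>"
  obtains d0 d1 where "d0 \<in> carrier L" "d1 \<in> carrier L"
    and "\<And>a0 a1 x. a0 \<in> carrier L \<Longrightarrow> a1 \<in> carrier L \<Longrightarrow> x \<in> {b, b'} \<Longrightarrow>
      quad (a0 \<oplus>\<^bsub>L\<^esub> d0) (a1 \<oplus>\<^bsub>L\<^esub> d1) (mask s' (a1 \<oplus>\<^bsub>L\<^esub> d1)) x = quad a0 a1 (mask s a1) x"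
proof -
  define c where "c = cc (b \<oplus>\<^bsub>L\<^esub> b')"
  \<comment> \<open>After the shift the mask is \<open>cc a1 - e c + s'\<close>; it must equal the
    old mask plus \<open>e\<close>, that is \<open>cc a1 + s + e\<close>. Solving for
    \<open>e\<close> gives this quotient.\<close>
  define e where "e = (s' \<ominus> s) \<otimes> inv (\<one> \<oplus> c)"
  \<comment> \<open>\<open>d1\<close> and \<open>d0\<close> are the linear and the constant
    coefficient of \<open>e (y - b) (y - b')\<close>.\<close>
  define d1 where "d1 = \<iota> (\<ominus> e) \<otimes>\<^bsub>L\<^esub> (b \<oplus>\<^bsub>L\<^esub> b')"
  define d0 where "d0 = \<iota> e \<otimes>\<^bsub>L\<^esub> b \<otimes>\<^bsub>L\<^esub> b'"
  have c: "c \<in> carrier R"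
    using assms unfolding c_def by (intro const_coeff_closed) auto
  then have "\<one> \<oplus> c \<in> Units R"
    using nz by (simp add: field_Units c_def)
  then have inv: "inv (\<one> \<oplus> c) \<in> carrier R" "inv (\<one> \<oplus> c) \<otimes> (\<one> \<oplus> c) = \<one>"
    by auto
  then have e: "e \<in> carrier R"
    using assms by (simp add: e_def)
  then have \<iota>e: "\<iota> e \<in> carrier L"
    by simp
  have d: "d0 \<in> carrier L" "d1 \<in> carrier L"
    using e assms by (auto simp: d0_def d1_def)
  have "e \<otimes> (\<one> \<oplus> c) = s' \<ominus> s"
    using inv c assms by (simp add: e_def m_assoc)
  \<comment> \<open>\<open>e\<close> stays opaque for \<open>algebra\<close>; only the product
    \<open>e (1 + c)\<close> is rewritten, so that no inverse occurs.\<close>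
  moreover have "e \<oplus> s = (\<ominus> e \<otimes> c \<oplus> e \<otimes> (\<one> \<oplus> c)) \<oplus> s"
    using c e assms(1) by algebra
  ultimately have "e \<oplus> s = (\<ominus> e \<otimes> c \<oplus> (s' \<ominus> s)) \<oplus> s"
    by simp
  also have "\<dots> = \<ominus> e \<otimes> c \<oplus> s'"
    using c e assms(1,2) by algebra
  also have "\<ominus> e \<otimes> c = cc d1"
    unfolding c_def d1_def using e assms by (intro const_coeff_smult[symmetric]) auto
  finally have e_eq: "e \<oplus> s = cc d1 \<oplus> s'" .
  have mask: "mask s' (a1 \<oplus>\<^bsub>L\<^esub> d1) = mask s a1 \<oplus> e" if "a1 \<in> carrier L" for a1
  proof -
    have "mask s' (a1 \<oplus>\<^bsub>L\<^esub> d1) = cc a1 \<oplus> (cc d1 \<oplus> s')"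
      using that d assms by (simp add: mask_eq const_coeff_add const_coeff_closed a_assoc)
    also have "\<dots> = cc a1 \<oplus> s \<oplus> e"
      using const_coeff_closed[OF that] e assms(1) by (simp add: e_eq[symmetric] a_ac)
    finally show ?thesis
      using that assms by (simp add: mask_eq)
  qed
  show thesis
  proof (rule that[OF d])
    fix a0 a1 x assume a: "a0 \<in> carrier L" "a1 \<in> carrier L" and x: "x \<in> {b, b'}"
    have m: "mask s a1 \<in> carrier R"
      using a assms mask_closed by auto
    then have \<iota>m: "\<iota> (mask s a1) \<in> carrier L"
      by simp
    \<comment> \<open>\<open>y\<close> is the evaluation point and \<open>z\<close> the other one;
      \<open>d0\<close> and \<open>d1\<close> are symmetric in the two.\<close>
    have "quad (a0 \<oplus>\<^bsub>L\<^esub> d0) (a1 \<oplus>\<^bsub>L\<^esub> d1) (mask s a1 \<oplus> e) y = quad a0 a1 (mask s a1) y"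
      if "y = b \<and> z = b' \<or> y = b' \<and> z = b" for y z
    proof -
      have yz: "y \<in> carrier L" "z \<in> carrier L"
        using that assms by auto
      have d_eq: "d0 = \<iota> e \<otimes>\<^bsub>L\<^esub> y \<otimes>\<^bsub>L\<^esub> z" "d1 = \<ominus>\<^bsub>L\<^esub> \<iota> e \<otimes>\<^bsub>L\<^esub> (y \<oplus>\<^bsub>L\<^esub> z)"
        using that \<iota>e e assms by (auto simp: d0_def d1_def L.m_ac L.a_ac)
      have \<iota>_add: "\<iota> (mask s a1 \<oplus> e) = \<iota> (mask s a1) \<oplus>\<^bsub>L\<^esub> \<iota> e"
        using m e by simp
      have sq: "y [^]\<^bsub>L\<^esub> (2::nat) = y \<otimes>\<^bsub>L\<^esub> y"
        using yz by (simp add: numeral_2_eq_2)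
      show ?thesis
        unfolding quad_def d_eq \<iota>_add sq
        by (rule L.quadratic_translate_fixing_two_points) fact+
    qed
    then have "quad (a0 \<oplus>\<^bsub>L\<^esub> d0) (a1 \<oplus>\<^bsub>L\<^esub> d1) (mask s a1 \<oplus> e) x = quad a0 a1 (mask s a1) x"
      using x by blast
    then show "quad (a0 \<oplus>\<^bsub>L\<^esub> d0) (a1 \<oplus>\<^bsub>L\<^esub> d1) (mask s' (a1 \<oplus>\<^bsub>L\<^esub> d1)) x = quad a0 a1 (mask s a1) x"
      by (simp only: mask[OF a(2)])
  qed
qed

text \<open>Here \<open>a2\<close> must not change, so the polynomial added is linear with root
  \<open>b\<close>, namely \<open>d1 (y - b)\<close>.\<close>

lemma translation_fixing_value_and_mask:
  assumes "s \<in> carrier R" "s' \<in> carrier R" "b \<in> carrier L"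
  obtains d0 d1 where "d0 \<in> carrier L" "d1 \<in> carrier L"
    and "\<And>a1. a1 \<in> carrier L \<Longrightarrow> mask s' (a1 \<oplus>\<^bsub>L\<^esub> d1) = mask s a1"
    and "\<And>a0 a1. a0 \<in> carrier L \<Longrightarrow> a1 \<in> carrier L \<Longrightarrow>
      quad (a0 \<oplus>\<^bsub>L\<^esub> d0) (a1 \<oplus>\<^bsub>L\<^esub> d1) (mask s' (a1 \<oplus>\<^bsub>L\<^esub> d1)) b = quad a0 a1 (mask s a1) b"
proof -
  \<comment> \<open>This constant changes \<open>cc a1\<close> by \<open>s - s'\<close>, which
    compensates for replacing \<open>s\<close> by \<open>s'\<close> in the mask.\<close>
  define d1 where "d1 = \<iota> (s \<ominus> s')"
  define d0 where "d0 = \<ominus>\<^bsub>L\<^esub> (d1 \<otimes>\<^bsub>L\<^esub> b)"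
  have d: "d0 \<in> carrier L" "d1 \<in> carrier L"
    using assms by (auto simp: d0_def d1_def)
  have cc_d1: "cc d1 = s \<ominus> s'"
    using assms by (simp add: d1_def const_coeff_const_class)
  have mask: "mask s' (a1 \<oplus>\<^bsub>L\<^esub> d1) = mask s a1" if "a1 \<in> carrier L" for a1
  proof -
    have "mask s' (a1 \<oplus>\<^bsub>L\<^esub> d1) = cc a1 \<oplus> (s \<ominus> s') \<oplus> s'"
      using that d assms by (simp add: mask_eq const_coeff_add cc_d1)
    also have "\<dots> = cc a1 \<oplus> s"
      using const_coeff_closed[OF that] assms(1,2) by algebra
    finally show ?thesis
      using that assms by (simp add: mask_eq)
  qed
  show thesis
  proof (rule that[OF d mask])
    fix a0 a1 assume a: "a0 \<in> carrier L" "a1 \<in> carrier L"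
    define q where "q = \<iota> (mask s a1) \<otimes>\<^bsub>L\<^esub> b [^]\<^bsub>L\<^esub> (2::nat)"
    have q: "q \<in> carrier L"
      using a assms mask_closed by (auto simp: q_def)
    show "quad (a0 \<oplus>\<^bsub>L\<^esub> d0) (a1 \<oplus>\<^bsub>L\<^esub> d1) (mask s' (a1 \<oplus>\<^bsub>L\<^esub> d1)) b = quad a0 a1 (mask s a1) b"
      unfolding quad_def mask[OF a(2)] q_def[symmetric] d0_def
      using a d(2) assms(3) q by algebra
  qed
qed

end

text \<open>Adding a fixed element permutes the finite carrier, hence preserves the uniform
  distribution. Views that agree pointwise up to translation therefore have equal
  distributions.\<close>

lemma (in abelian_group) map_pmf_translate_pair:
  assumes "finite (carrier G)" "d0 \<in> carrier G" "d1 \<in> carrier G"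
    and "\<And>a0 a1. a0 \<in> carrier G \<Longrightarrow> a1 \<in> carrier G \<Longrightarrow> f (a0, a1) = f' (a0 \<oplus> d0, a1 \<oplus> d1)"
  defines "U \<equiv> pmf_of_set (carrier G)"
  shows "map_pmf f (pair_pmf U U) = map_pmf f' (pair_pmf U U)"
proof -
  have ne: "carrier G \<noteq> {}"
    using zero_closed by blast
  have translate: "map_pmf (\<lambda>a. a \<oplus> d) U = U" if "d \<in> carrier G" for d
    unfolding U_def
  proof (rule map_pmf_of_set_bij_betw)
    show "bij_betw (\<lambda>a. a \<oplus> d) (carrier G) (carrier G)"
      using that by (intro bij_betwI[where g = "\<lambda>a. a \<ominus> d"]) (auto simp: minus_eq a_assoc l_neg r_neg)
  qed (use ne assms in auto)
  have "map_pmf f (pair_pmf U U)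
      = map_pmf (f' \<circ> map_prod (\<lambda>a. a \<oplus> d0) (\<lambda>a. a \<oplus> d1)) (pair_pmf U U)"
    using assms ne by (intro map_pmf_cong) (auto simp: U_def)
  also have "\<dots> = map_pmf f' (pair_pmf U U)"
    using assms(2,3)
    by (simp add: pmf.map_comp[symmetric] map_prod_def map_pair translate)
  finally show ?thesis .
qed


section \<open>Correctness and secrecy\<close>

lemma field_F2: "Ring.field F2"
proof -
  interpret residues_prime 2 F2
    by unfold_locales simp_all
  show ?thesis
    by (rule is_field)
qed

locale sharing_scheme =
  F: residue_field_extension F2 l g + K: residue_field_extension "small_field g" m g1
  for l m :: nat and g :: "int list" and g1 :: "int list set list"
begin

abbreviation L where "L \<equiv> large_field g g1"

section \<open>Evaluation points and their binary digits\<close>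

abbreviation bits where "bits j k r \<equiv> of_bool (bit j (k * Polynomials.degree g + r)) :: int"

lemma bits_closed: "(\<lambda>r. bits j k r) \<in> {..<l} \<rightarrow> carrier F2"
  by (auto simp: residue_ring_def)

lemma blocks_closed: "(\<lambda>k. power_sum F2 g (bits j k)) \<in> {..<m} \<rightarrow> carrier (small_field g)"
  using F.power_sum_closed[OF bits_closed] by auto

lemma beta_closed: "beta g g1 j \<in> carrier L"
  unfolding beta_def using K.power_sum_closed[OF blocks_closed] .

text \<open>Digit \<open>t\<close> of the index is digit \<open>t mod l\<close> of block
  \<open>t div l\<close>. Uniqueness of coordinates over the small field recovers the block, and
  uniqueness over \<open>F2\<close> then recovers the digit.\<close>

lemma beta_inj:
  assumes "i < 2 ^ (l * m)" "j < 2 ^ (l * m)" "beta g g1 i = beta g g1 j"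
  shows "i = j"
proof -
  have "bit i t = bit j t" if "t < l * m" for t
  proof -
    have lt: "t div l < m" "t mod l < l"
      using that F.n_pos by (auto simp: less_mult_imp_div_less mult.commute)
    have "power_sum F2 g (bits i (t div l)) = power_sum F2 g (bits j (t div l))"
      using K.power_sum_inj[OF blocks_closed blocks_closed _ lt(1)] assms(3)
      unfolding beta_def .
    then have "bits i (t div l) (t mod l) = bits j (t div l) (t mod l)"
      using F.power_sum_inj[OF bits_closed bits_closed _ lt(2)] by blast
    then show ?thesis
      unfolding F.degree_p by (simp add: of_bool_eq_iff)
  qed
  then have "take_bit (l * m) i = take_bit (l * m) j"
    by (auto intro!: bit_eqI simp: bit_take_bit_iff)
  then show ?thesis
    using assms(1,2) by (simp add: take_bit_nat_eq_self)
qed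

text \<open>Taking constant coefficients twice extracts bit 0 of the index, which vanishes for even
  indices.\<close>

lemma const_coeff_const_coeff_beta:
  "const_coeff F2 g (K.cc (beta g g1 (2 * i))) = \<zero>\<^bsub>F2\<^esub>"
  unfolding beta_def K.const_coeff_power_sum[OF blocks_closed] F.const_coeff_power_sum[OF bits_closed]
  by (simp add: residue_ring_def bit_0)

text \<open>The constant coefficient over \<open>F2\<close> of the left side is
  \<open>1 + 0 + 0\<close>. This supplies the invertibility required by
  \<open>translation_fixing_two_values\<close>.\<close>

lemma one_plus_const_coeff_nonzero:
  "\<one>\<^bsub>small_field g\<^esub> \<oplus>\<^bsub>small_field g\<^esub> K.cc (beta g g1 (2 * i) \<oplus>\<^bsub>L\<^esub> beta g g1 (2 * j))
    \<noteq> \<zero>\<^bsub>small_field g\<^esub>" (is "?x \<noteq> _")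
proof
  assume "?x = \<zero>\<^bsub>small_field g\<^esub>"
  \<comment> \<open>Zero, and below also one, is treated as an embedded constant, so that
    \<open>const_coeff_const_class\<close> yields its constant coefficient.\<close>
  also have "\<dots> = F.\<iota> \<zero>\<^bsub>F2\<^esub>"
    by simp
  finally have "const_coeff F2 g ?x = \<zero>\<^bsub>F2\<^esub>"
    by (simp only: F.const_coeff_const_class F.zero_closed)
  moreover have "const_coeff F2 g \<one>\<^bsub>small_field g\<^esub> = \<one>\<^bsub>F2\<^esub>"
    using F.const_coeff_const_class[OF F.one_closed] by simp
  then have "const_coeff F2 g ?x = \<one>\<^bsub>F2\<^esub>"
    by (simp add: K.const_coeff_add beta_closed F.const_coeff_add K.const_coeff_closed
        const_coeff_const_coeff_beta)
  ultimately show False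
    by simp
qed

section \<open>Shares as values and masks\<close>

lemma shares_Z: "shares g g1 s a0 a1 (Z_share i)
    = Inl (K.quad a0 a1 (K.mask s a1) (beta g g1 (2 * i)))"
  and shares_A2: "shares g g1 s a0 a1 A2_share = Inr (K.mask s a1)"
  by (simp_all add: shares_def K.quad_def K.mask_def Let_def)

lemma finite_carrier_L: "finite (carrier L)"
  by (intro K.finite_carrier_L F.finite_carrier_L) (simp add: residue_ring_def)

lemma set_pmf_deal:
  "set_pmf (deal g g1 s) = (\<lambda>(a0, a1). shares g g1 s a0 a1) ` (carrier L \<times> carrier L)"
proof -
  have "carrier L \<noteq> {}"
    using K.L.zero_closed by blast
  then show ?thesis
    using finite_carrier_L by (simp add: deal_def set_pmf_of_set)
qed

lemma beta_positions_inj: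
  assumes "Z_share i \<in> positions l m" "Z_share j \<in> positions l m" "i \<noteq> j"
  shows "beta g g1 (2 * i) \<noteq> beta g g1 (2 * j)"
proof
  assume eq: "beta g g1 (2 * i) = beta g g1 (2 * j)"
  \<comment> \<open>Positivity keeps the natural subtraction in \<open>l * m - 1\<close> from
    truncating.\<close>
  have "0 < l * m"
    using F.n_pos K.n_pos by simp
  then have pow: "(2::nat) ^ (l * m) = 2 * 2 ^ (l * m - 1)"
    by (simp flip: power_Suc)
  have "2 * k < 2 ^ (l * m)" if "Z_share k \<in> positions l m" for k
  proof -
    have "k \<le> 2 ^ (l * m - 1) - 1"
      using that by (auto simp: positions_def)
    moreover have "(0::nat) < 2 ^ (l * m - 1)"
      by simp
    ultimately show ?thesis
      unfolding pow by linarith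
  qed
  with assms have "2 * i = 2 * j"
    by (intro beta_inj eq)
  with assms(3) show False
    by simp
qed

lemma correct: "perfectly_correct (carrier (small_field g)) (positions l m) (deal g g1) 3"
  unfolding perfectly_correct_def
proof (intro allI impI, elim conjE)
  fix A assume A: "A \<subseteq> positions l m" "card A = 3"
  let ?S = "carrier (small_field g)"
  \<comment> \<open>Reconstruction reduces to this: a view at \<open>A\<close> is compatible with at
    most one secret.\<close>
  have determined: "s = s'"
    if s: "s \<in> ?S" "s' \<in> ?S"
      and sh: "sh \<in> set_pmf (deal g g1 s)" "sh' \<in> set_pmf (deal g g1 s')"
      and eq: "restrict sh A = restrict sh' A" for s s' sh sh'
  proof -
    obtain a0 a1 where a: "a0 \<in> carrier L" "a1 \<in> carrier L" "sh = shares g g1 s a0 a1"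
      using sh(1) by (auto simp: set_pmf_deal)
    obtain a0' a1' where a': "a0' \<in> carrier L" "a1' \<in> carrier L" "sh' = shares g g1 s' a0' a1'"
      using sh(2) by (auto simp: set_pmf_deal)
    have at: "sh x = sh' x" if "x \<in> A" for x
      using fun_cong[OF eq, of x] that by simp
    have Z: "K.quad a0 a1 (K.mask s a1) (beta g g1 (2 * i))
        = K.quad a0' a1' (K.mask s' a1') (beta g g1 (2 * i))" if "Z_share i \<in> A" for i
      using at[OF that] by (simp add: a a' shares_Z)
    have neq: "beta g g1 (2 * i) \<noteq> beta g g1 (2 * j)"
      if "Z_share i \<in> A" "Z_share j \<in> A" "i \<noteq> j" for i j
      using beta_positions_inj that A(1) by blast
    show "s = s'"
    proof (cases "A2_share \<in> A")
      case True
      then have "card (A - {A2_share}) = 2"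
        using A(2) by simp
      then obtain x y where xy: "A - {A2_share} = {x, y}" "x \<noteq> y"
        by (auto simp: card_2_iff)
      obtain i where i: "x = Z_share i"
        using xy(1) by (cases x) auto
      obtain j where j: "y = Z_share j"
        using xy(1) by (cases y) auto
      have ij: "Z_share i \<in> A" "Z_share j \<in> A" "i \<noteq> j"
        using xy i j by auto
      have "K.mask s a1 = K.mask s' a1'"
        using at[OF True] by (simp add: a a' shares_A2)
      then show ?thesis
        using Z[OF ij(1)] Z[OF ij(2)]
        by (intro K.two_values_and_mask_determine_secret[OF a(1,2) s(1) a'(1,2) s(2)
              beta_closed beta_closed neq[OF ij]]) auto
    next
      case False
      obtain x y z where xyz: "A = {x, y, z}" "x \<noteq> y" "x \<noteq> z" "y \<noteq> z"
        using A(2) by (auto simp: card_3_iff)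
      obtain i where i: "x = Z_share i"
        using False xyz(1) by (cases x) auto
      obtain j where j: "y = Z_share j"
        using False xyz(1) by (cases y) auto
      obtain k where k: "z = Z_share k"
        using False xyz(1) by (cases z) auto
      have mem: "Z_share i \<in> A" "Z_share j \<in> A" "Z_share k \<in> A"
        and ne: "i \<noteq> j" "i \<noteq> k" "j \<noteq> k"
        using xyz i j k by auto
      show ?thesis
        using Z[OF mem(1)] Z[OF mem(2)] Z[OF mem(3)]
        by (intro K.three_values_determine_secret[OF a(1,2) s(1) a'(1,2) s(2)
              beta_closed beta_closed beta_closed neq[OF mem(1,2) ne(1)] neq[OF mem(1,3) ne(2)]
              neq[OF mem(2,3) ne(3)]]) auto
    qed
  qed
  \<comment> \<open>Some compatible secret is picked; on views that never arise the value is
    arbitrary.\<close>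
  define recover where
    "recover r = (SOME s. s \<in> ?S \<and> (\<exists>sh\<in>set_pmf (deal g g1 s). restrict sh A = r))" for r
  have "recover (restrict sh A) = s" if "s \<in> ?S" "sh \<in> set_pmf (deal g g1 s)" for s sh
    unfolding recover_def
  proof (rule some_equality)
    show "s \<in> ?S \<and> (\<exists>sh'\<in>set_pmf (deal g g1 s). restrict sh' A = restrict sh A)"
      using that by blast
  qed (use determined that in blast)
  then show "\<exists>recover. \<forall>s\<in>?S. \<forall>sh\<in>set_pmf (deal g g1 s). recover (restrict sh A) = s"
    by blast
qed

text \<open>An upper bound for \<open>A\<close> suffices, since preserving more shares is stronger.
  Smaller sets are padded, so \<open>i\<close> and \<open>j\<close> may coincide and need not be
  valid indices.\<close>

lemma positions_subset_cases:
  assumes "A \<subseteq> positions l m" "card A < 3"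
  obtains i j where "A \<subseteq> {Z_share i, Z_share j}" | i where "A \<subseteq> {Z_share i, A2_share}"
proof -
  have "finite A"
    using assms(1) by (rule finite_subset) (simp add: positions_def)
  have "card A = 0 \<or> card A = 1 \<or> card A = 2"
    using assms(2) by linarith
  then obtain x y where sub: "A \<subseteq> {x, y}"
    using \<open>finite A\<close> by (auto simp: card_2_iff card_1_singleton_iff)
  show thesis
  proof (cases x)
    case x: (Z_share i)
    show thesis
    proof (cases y)
      case (Z_share j)
      then show thesis
        using that(1)[of i j] sub x by simp
    next
      case A2_share
      then show thesis
        using that(2)[of i] sub x by simp
    qed
  next
    case x: A2_share
    show thesis
    proof (cases y)
      case (Z_share j)
      then show thesis
        using that(2)[of j] sub x by (simp add: insert_commute)
    next
      case A2_share
      then show thesis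
        \<comment> \<open>Only the share \<open>a2\<close> can occur here; index 0 is
          padding.\<close>
        using that(2)[of 0] sub x by auto
    qed
  qed
qed

lemma secret: "perfectly_secret (carrier (small_field g)) (positions l m) (deal g g1) 3"
  unfolding perfectly_secret_def
proof (intro allI impI ballI, elim conjE)
  fix A s s'
  assume A: "A \<subseteq> positions l m" "card A < 3"
    and s: "s \<in> carrier (small_field g)" "s' \<in> carrier (small_field g)"
  \<comment> \<open>The translation may depend on \<open>A\<close>, \<open>s\<close> and
    \<open>s'\<close>, but one choice must serve all \<open>a0\<close> and \<open>a1\<close> for the
    distributions to agree.\<close>
  have "\<exists>d0\<in>carrier L. \<exists>d1\<in>carrier L. \<forall>a0\<in>carrier L. \<forall>a1\<in>carrier L. \<forall>x\<in>A.
    shares g g1 s a0 a1 x = shares g g1 s' (a0 \<oplus>\<^bsub>L\<^esub> d0) (a1 \<oplus>\<^bsub>L\<^esub> d1) x"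
    using A
  proof (rule positions_subset_cases)
    fix i j assume sub: "A \<subseteq> {Z_share i, Z_share j}"
    show ?thesis
    proof (rule K.translation_fixing_two_values[OF s beta_closed beta_closed
          one_plus_const_coeff_nonzero[of i j]], intro bexI ballI)
      fix d0 d1 a0 a1 x
      assume fixing: "\<And>a0 a1 x. a0 \<in> carrier L \<Longrightarrow> a1 \<in> carrier L \<Longrightarrow>
          x \<in> {beta g g1 (2 * i), beta g g1 (2 * j)} \<Longrightarrow>
          K.quad (a0 \<oplus>\<^bsub>L\<^esub> d0) (a1 \<oplus>\<^bsub>L\<^esub> d1) (K.mask s' (a1 \<oplus>\<^bsub>L\<^esub> d1)) x
            = K.quad a0 a1 (K.mask s a1) x"
        and a: "a0 \<in> carrier L" "a1 \<in> carrier L" and "x \<in> A"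
      then have "x = Z_share i \<or> x = Z_share j"
        using sub by blast
      then show "shares g g1 s a0 a1 x = shares g g1 s' (a0 \<oplus>\<^bsub>L\<^esub> d0) (a1 \<oplus>\<^bsub>L\<^esub> d1) x"
        by (elim disjE) (simp_all add: shares_Z fixing[OF a])
    qed
  next
    fix i assume sub: "A \<subseteq> {Z_share i, A2_share}"
    show ?thesis
    proof (rule K.translation_fixing_value_and_mask[OF s beta_closed[of "2 * i"]],
        intro bexI ballI)
      fix d0 d1 a0 a1 x
      assume fixing: "\<And>a1. a1 \<in> carrier L \<Longrightarrow> K.mask s' (a1 \<oplus>\<^bsub>L\<^esub> d1) = K.mask s a1"
          "\<And>a0 a1. a0 \<in> carrier L \<Longrightarrow> a1 \<in> carrier L \<Longrightarrow>
            K.quad (a0 \<oplus>\<^bsub>L\<^esub> d0) (a1 \<oplus>\<^bsub>L\<^esub> d1) (K.mask s' (a1 \<oplus>\<^bsub>L\<^esub> d1)) (beta g g1 (2 * i))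
              = K.quad a0 a1 (K.mask s a1) (beta g g1 (2 * i))"
        and a: "a0 \<in> carrier L" "a1 \<in> carrier L" and "x \<in> A"
      then have "x = Z_share i \<or> x = A2_share"
        using sub by blast
      then show "shares g g1 s a0 a1 x = shares g g1 s' (a0 \<oplus>\<^bsub>L\<^esub> d0) (a1 \<oplus>\<^bsub>L\<^esub> d1) x"
        by (elim disjE)
          (simp only: shares_Z fixing(2)[OF a], simp only: shares_A2 fixing(1)[OF a(2)])
    qed
  qed
  then obtain d0 d1 where d: "d0 \<in> carrier L" "d1 \<in> carrier L"
    and fixing: "\<forall>a0\<in>carrier L. \<forall>a1\<in>carrier L. \<forall>x\<in>A.
      shares g g1 s a0 a1 x = shares g g1 s' (a0 \<oplus>\<^bsub>L\<^esub> d0) (a1 \<oplus>\<^bsub>L\<^esub> d1) x"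
    by blast
  let ?f = "\<lambda>s (a0, a1). restrict (shares g g1 s a0 a1) A"
  let ?U = "pmf_of_set (carrier L)"
  have "map_pmf (?f s) (pair_pmf ?U ?U) = map_pmf (?f s') (pair_pmf ?U ?U)"
    by (rule K.L.map_pmf_translate_pair[OF finite_carrier_L d])
      (use fixing in \<open>auto intro!: restrict_ext\<close>)
  then show "map_pmf (\<lambda>sh. restrict sh A) (deal g g1 s) = map_pmf (\<lambda>sh. restrict sh A) (deal g g1 s')"
    by (simp add: deal_def map_pmf_comp case_prod_unfold)
qed

lemma card_positions: "card (positions l m) = 2 ^ (l * m - 1) + 1"
proof -
  have "card (Z_share ` {i. i \<le> 2 ^ (l * m - 1) - 1}) = card {..2 ^ (l * m - 1) - 1 :: nat}"
    by (subst card_image) (auto simp: inj_on_def atMost_def)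
  then show ?thesis
    unfolding positions_def by (subst card_insert_disjoint) auto
qed

end

theorem mainTheorem4:
  fixes l m :: nat and g :: "int list" and g1 :: "int list set list"
  assumes "l \<ge> 1" and "m \<ge> 1"
    and "monic_irreducible F2 l g"
    and "monic_irreducible (small_field g) m g1"
  shows "threshold_scheme (carrier (small_field g)) (positions l m) (deal g g1)
           3 (2 ^ (l * m - 1) + 1)"
proof -
  interpret F: residue_field_extension F2 l g
    using field_F2 assms(3) by (simp add: residue_field_extension_def residue_field_extension_axioms_def)
  interpret K: residue_field_extension "small_field g" m g1
    using F.field_L assms(4) by (simp add: residue_field_extension_def residue_field_extension_axioms_def)
  interpret sharing_scheme l m g g1 ..
  show ?thesis
    unfolding threshold_scheme_def
    using correct secret card_positions by (simp add: positions_def)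
qed

end
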